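(* Let $W$ be a separable Fréchet space with Borel sigma-algebra $\mathcal B(W)$ and let $H$ be a separable Hilbert space injected densely and continuously into $W$. Assume that $\rho$ and $\nu$ are two probability measures on $(W,\mathcal B(W))$ which are at locally finite Wasserstein distance from each other and that $\rho$ is a spread measure. Then there exists a map $T:W\to W$ of the form $T=I_W+\xi$ with $\xi$ taking values in $H$ $\rho$-almost surely (i.e. $T$ is a perturbation of identity) such that $T$ maps $\rho$ to $\nu$, i.e. $T\rho=\nu$.
   Context: $T\rho$ denotes the image of $\rho$ under $T$; $I_W$ is the identity map of $W$. For probabilities $\xi,\eta$ on $W$, $\Sigma(\xi,\eta)$ is the set of probability measures on $W\times W$ with first marginal $\xi$ and second marginal $\eta$, and $$d_H^2(\xi,\eta)=\inf\left\{\int_{W\times W}|x-y|_H^2\,d\beta(x,y):\beta\in\Sigma(\xi,\eta)\right\},$$ with $|x-y|_H=\infty$ if $x-y\notin H$. Locally finite Wasserstein distance: $\rho$ and $\nu$ are at locally finite Wasserstein distance from each other if there is a (countable) measurable partition $(Z_n,n\ge1)$ of $W$ such that $d_H(\rho,\nu_n)<\infty$ for every $n\ge1$, where $\nu_n(A)=\nu(A\cap Z_n)/\nu(Z_n)$ (so $\nu(Z_n)>0$). Spread measure: a finite-dimensional orthogonal projection of $H$ is called regular if it has a continuous extension to $W$ (denoted by the same symbol). A probability $m$ on $(W,\mathcal B(W))$ is a spread measure if there is a sequence of finite-dimensional regular projections $(\pi_n,n\ge1)$ converging to $I_H$ (with $\pi_n$ of rank $n$) such that, with $\pi_n^\perp=I_W-\pi_n$,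 the regular conditional probabilities $m(\,\cdot\mid\pi_n^\perp=x_n^\perp)$, which are concentrated on the $n$-dimensional affine spaces $\pi_n(W)+x_n^\perp$, vanish on the sets of Hausdorff dimension $n-1$ for $\pi_n^\perp(m)$-almost all $x_n^\perp$ and for every $n\ge1$. *)

theory Defs
  imports "HOL-Probability.Probability"
begin

text \<open>
  A Frechet space is a locally convex topological vector space whose topology is given by a
  complete translation-invariant metric. Separability is expressed, as usual for metric spaces,
  by the additional class \<^class>\<open>second_countable_topology\<close> (contained in \<^class>\<open>polish_space\<close>).
  In the last axiom \<^const>\<open>convex\<close> is written out, as it cannot be used inside a class specification.
\<close>

class frechet_space = real_vector + topological_ab_group_add + complete_space +
  assumes tendsto_scaleR_nhds:
    "filterlim (\<lambda>q. fst q *\<^sub>R snd q) (nhds (r *\<^sub>R x)) (nhds r \<times>\<^sub>F nhds x)"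
  and dist_translation_invariant: "dist (x + z) (y + z) = dist x y"
  and locally_convex: "open U \<Longrightarrow> 0 \<in> U \<Longrightarrow> \<exists>V. open V \<and> 0 \<in> V \<and> V \<subseteq> U \<and>
       (\<forall>x\<in>V. \<forall>y\<in>V. \<forall>u\<ge>0. \<forall>v\<ge>0. u + v = 1 \<longrightarrow> u *\<^sub>R x + v *\<^sub>R y \<in> V)"

text \<open>
  Throughout, \<open>j :: 'h \<Rightarrow> 'w\<close> is the injection of \<open>H\<close> into \<open>W\<close>; \<open>H\<close>, as a subset of \<open>W\<close>, is
  \<open>range j\<close>.
\<close>

definition H_norm :: "('h::real_inner \<Rightarrow> 'w) \<Rightarrow> 'w \<Rightarrow> ennreal" where
  "H_norm j w = (if w \<in> range j then ennreal (norm (inv j w)) else \<top>)"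

definition couplings ::
  "'w::topological_space measure \<Rightarrow> 'w measure \<Rightarrow> ('w \<times> 'w) measure set" where
  "couplings \<xi> \<eta> =
     {\<beta>. prob_space \<beta> \<and> sets \<beta> = sets (borel \<Otimes>\<^sub>M borel) \<and>
         distr \<beta> borel fst = \<xi> \<and> distr \<beta> borel snd = \<eta>}"

definition wasserstein_sq ::
  "('h::real_inner \<Rightarrow> 'w::{real_vector, topological_space}) \<Rightarrow> 'w measure \<Rightarrow> 'w measure \<Rightarrow> ennreal"
  where "wasserstein_sq j \<xi> \<eta> =
     (INF \<beta>\<in>couplings \<xi> \<eta>. \<integral>\<^sup>+ z. (H_norm j (fst z - snd z))\<^sup>2 \<partial>\<beta>)"

definition wasserstein ::
  "('h::real_inner \<Rightarrow> 'w::{real_vector, topological_space}) \<Rightarrow> 'w measure \<Rightarrow> 'w measure \<Rightarrow> ennreal"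
  where "wasserstein j \<xi> \<eta> =
     (if wasserstein_sq j \<xi> \<eta> = \<top> then \<top>
      else ennreal (sqrt (enn2real (wasserstein_sq j \<xi> \<eta>))))"

text \<open>
  The partition may be finite or countably infinite; \<^term>\<open>uniform_measure \<nu> Z\<close> is the normalized
  restriction \<open>A \<mapsto> \<nu> (A \<inter> Z) / \<nu> Z\<close>.
\<close>

definition locally_finite_wasserstein ::
  "('h::real_inner \<Rightarrow> 'w::{real_vector, topological_space}) \<Rightarrow> 'w measure \<Rightarrow> 'w measure \<Rightarrow> bool"
  where "locally_finite_wasserstein j \<rho> \<nu> \<longleftrightarrow>
     (\<exists>P. countable P \<and> partition_on UNIV P \<and> P \<subseteq> sets borel \<and>
        (\<forall>Z\<in>P. emeasure \<nu> Z > 0 \<and> wasserstein j \<rho> (uniform_measure \<nu> Z) < \<top>))"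

definition hausdorff_pre :: "real \<Rightarrow> real \<Rightarrow> 'a::metric_space set \<Rightarrow> ennreal" where
  "hausdorff_pre s \<delta> A =
     (INF C\<in>{C :: nat \<Rightarrow> 'a set. A \<subseteq> (\<Union>i. C i) \<and> (\<forall>i. bounded (C i) \<and> diameter (C i) \<le> \<delta>)}.
        \<Sum>i. ennreal (diameter (C i) powr s))"

definition hausdorff_measure :: "real \<Rightarrow> 'a::metric_space set \<Rightarrow> ennreal" where
  "hausdorff_measure s A = (SUP \<delta>\<in>{0<..}. hausdorff_pre s \<delta> A)"

text \<open>
  Exponent \<open>s = 0\<close> is left out because \<open>0 powr 0 = 0\<close>; this does not change the infimum.
  The infimum of the empty set is \<^term>\<open>\<top>::ennreal\<close>.
\<close>

definition hausdorff_dim :: "'a::metric_space set \<Rightarrow> ennreal" where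
  "hausdorff_dim A = (INF s\<in>{s. 0 < s \<and> hausdorff_measure s A = 0}. ennreal s)"

text \<open>
  The orthogonality condition makes \<open>\<pi>\<close> the orthogonal projection onto its range; linearity and
  idempotence follow.
\<close>

definition fin_dim_orthogonal_projection :: "('h::real_inner \<Rightarrow> 'h) \<Rightarrow> bool" where
  "fin_dim_orthogonal_projection \<pi> \<longleftrightarrow>
     (\<exists>B. finite B \<and> range \<pi> = span B) \<and> (\<forall>x. \<forall>v\<in>range \<pi>. orthogonal (x - \<pi> x) v)"

text \<open>
  \<open>\<pi>\<close> is a regular projection of \<open>H\<close> with continuous extension \<open>p\<close> to \<open>W\<close>. As \<open>j\<close> has dense range,
  \<open>p\<close> is unique, and it takes its values in the finite-dimensional space \<open>range \<pi>\<close>.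
\<close>

definition regular_projection ::
  "('h::real_inner \<Rightarrow> 'w::topological_space) \<Rightarrow> ('h \<Rightarrow> 'h) \<Rightarrow> ('w \<Rightarrow> 'h) \<Rightarrow> bool" where
  "regular_projection j \<pi> p \<longleftrightarrow>
     fin_dim_orthogonal_projection \<pi> \<and> continuous_on UNIV p \<and> (\<forall>h. p (j h) = \<pi> h)"

text \<open>\<open>\<kappa> x\<close> is a regular version of the conditional probability \<open>m (\<cdot> | f = x)\<close>.\<close>

definition regular_conditional_prob ::
  "'w::topological_space measure \<Rightarrow> ('w \<Rightarrow> 'w) \<Rightarrow> ('w \<Rightarrow> 'w measure) \<Rightarrow> bool" where
  "regular_conditional_prob m f \<kappa> \<longleftrightarrow>
     \<kappa> \<in> borel \<rightarrow>\<^sub>M prob_algebra borel \<and>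
     (\<forall>A\<in>sets borel. \<forall>B\<in>sets borel.
        emeasure m (A \<inter> f -` B) = (\<integral>\<^sup>+ x\<in>B. emeasure (\<kappa> x) A \<partial>distr m borel f))"

text \<open>
  The complementary projection on \<open>W\<close> is \<open>w \<mapsto> w - j (p n w)\<close>, and its fibre over \<open>x\<close> is the affine
  space \<open>x + j (range (\<pi> n))\<close>. Hausdorff dimension in this space is taken with respect to the
  Euclidean metric carried over from \<open>H\<close>, since the invariant metric of \<open>W\<close> need not be Lipschitz
  equivalent to a norm on finite-dimensional subspaces. Regular conditional probabilities exist
  and are almost surely unique on Polish spaces, so the choice of \<open>\<kappa>\<close> does not matter.
\<close>

definition spread_measure ::
  "('h::real_inner \<Rightarrow> 'w::{real_vector, topological_space}) \<Rightarrow> 'w measure \<Rightarrow> bool" where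
  "spread_measure j m \<longleftrightarrow>
     (\<exists>(\<pi> :: nat \<Rightarrow> 'h \<Rightarrow> 'h) (p :: nat \<Rightarrow> 'w \<Rightarrow> 'h).
        (\<forall>n\<ge>1. regular_projection j (\<pi> n) (p n) \<and> dim (range (\<pi> n)) = n) \<and>
        (\<forall>h. (\<lambda>n. \<pi> n h) \<longlonglongrightarrow> h) \<and>
        (\<forall>n\<ge>1. \<exists>\<kappa>. regular_conditional_prob m (\<lambda>w. w - j (p n w)) \<kappa> \<and>
           (AE x in distr m borel (\<lambda>w. w - j (p n w)).
              \<forall>A\<in>sets borel. A \<subseteq> (\<lambda>h. x + j h) ` range (\<pi> n) \<longrightarrow>
                hausdorff_dim {h \<in> range (\<pi> n). x + j h \<in> A} = ennreal (real n - 1) \<longrightarrow>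
                emeasure (\<kappa> x) A = 0)))"

end

theory Submission
  imports Defs
begin

text \<open>
  No optimal transport is needed. Finite cost only serves to provide, after mixing the couplings
  of \<open>\<rho>\<close> with the pieces of \<open>\<nu>\<close>, a coupling \<open>(X, Y)\<close> of \<open>\<rho>\<close> and \<open>\<nu>\<close> with \<open>X - Y \<in> H\<close> almost surely.
  Of the spread condition only the case \<open>n = 1\<close> matters: given \<open>f w = w - \<pi>\<^sub>1 w\<close>, the measure
  \<open>\<rho>\<close> has no atoms on the line \<open>f w + \<pi>\<^sub>1 H\<close>, so the conditional distribution function of the
  coordinate on this line, evaluated at \<open>w\<close>, is uniform on the unit interval and independent of
  \<open>f w\<close>. With this randomness one samples \<open>T w\<close> from the conditional law of \<open>Y\<close> given \<open>f X = f w\<close>.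
  Then \<open>(f w, T w)\<close> has the law of \<open>(f X, Y)\<close>; since \<open>f X - Y\<close> and \<open>w - f w\<close> lie in \<open>H\<close>, so does
  \<open>T w - w\<close>.
\<close>

subsection \<open>Measurability of the norm of \<open>H\<close> on \<open>W\<close>\<close>

lemma LIMSEQ_dist_less_inverse:
  fixes x :: "nat \<Rightarrow> 'a::metric_space"
  assumes "\<And>n. dist (x n) l < 1 / real (Suc n)"
  shows "x \<longlonglongrightarrow> l"
proof (rule tendsto_dist_iff[THEN iffD2], rule tendsto_sandwich[OF _ _ tendsto_const LIMSEQ_inverse_real_of_nat])
  show "\<forall>\<^sub>F n in sequentially. dist (x n) l \<le> inverse (real (Suc n))"
    using assms by (intro always_eventually allI) (simp add: inverse_eq_divide less_imp_le)
qed simp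

text \<open>Stands in for weak compactness of balls. Each \<open>g m\<close> almost minimizes the
  norm on \<open>D m\<close>; the infima of the squared norms increase and stay bounded, hence
  converge, and the parallelogram law then makes \<open>g\<close> Cauchy.\<close>

lemma decseq_convex_bounded_convergent:
  fixes D :: "nat \<Rightarrow> 'h::{real_inner, complete_space} set"
  assumes "decseq D" "\<And>m. convex (D m)" "\<And>m. D m \<noteq> {}" "bounded (D 0)"
  obtains g l where "\<And>m. g m \<in> D m" "g \<longlonglongrightarrow> l"
proof -
  define q where "q m = (INF h\<in>D m. (norm h)\<^sup>2)" for m
  obtain B where B: "\<And>h. h \<in> D 0 \<Longrightarrow> norm h \<le> B"
    using assms(4) unfolding bounded_iff by blast
  have sub: "D k \<subseteq> D m" if "m \<le> k" for m k
    using assms(1) that by (auto simp: decseq_def)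
  have bdd: "bdd_below ((\<lambda>h. (norm h)\<^sup>2) ` D m)" for m
    by (intro bdd_belowI2[where m=0]) auto
  have q_le: "q m \<le> (norm h)\<^sup>2" if "h \<in> D m" for m h
    unfolding q_def using bdd that by (rule cINF_lower)
  have "\<exists>h\<in>D m. (norm h)\<^sup>2 < q m + 1 / real (Suc m)" for m
    using cINF_less_iff[OF assms(3) bdd, of m "q m + 1 / real (Suc m)"] by (auto simp: q_def)
  then obtain g where g: "\<And>m. g m \<in> D m" "\<And>m. (norm (g m))\<^sup>2 < q m + 1 / real (Suc m)"
    by metis
  have "incseq q"
    unfolding incseq_def q_def
    using sub assms(3) bdd by (auto intro!: cINF_superset_mono)
  moreover have "q m \<le> B\<^sup>2" for m
  proof -
    have "g m \<in> D 0" using g(1) sub by blast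
    then have "(norm (g m))\<^sup>2 \<le> B\<^sup>2" by (intro power_mono B) auto
    with q_le[OF g(1)] show ?thesis by (rule order_trans)
  qed
  ultimately obtain L where L: "q \<longlonglongrightarrow> L" "\<And>m. q m \<le> L"
    using incseq_convergent by metis
  \<comment> \<open>The midpoint of \<open>g k\<close> and \<open>g m\<close> lies in the convex set
    \<open>D m\<close>, so its squared norm is at least \<open>q m\<close>; the parallelogram law
    turns this into a bound depending on \<open>m\<close> only.\<close>
  have key: "(norm (g k - g m))\<^sup>2 \<le> 2 * (L - q m) + 4 / real (Suc m)" if "m \<le> k" for m k
  proof -
    have "(1/2) *\<^sub>R g k + (1/2) *\<^sub>R g m \<in> D m"
      using assms(2)[of m] g(1) sub[OF that] by (intro convexD) auto
    from q_le[OF this] have "4 * q m \<le> (norm (g k + g m))\<^sup>2"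
      by (simp flip: scaleR_add_right add: power_divide)
    moreover have "(norm (g k - g m))\<^sup>2 = 2 * (norm (g k))\<^sup>2 + 2 * (norm (g m))\<^sup>2 - (norm (g k + g m))\<^sup>2"
      by (simp add: power2_norm_eq_inner inner_diff inner_add inner_commute)
    moreover have "1 / real (Suc k) \<le> 1 / real (Suc m)"
      using that by (intro divide_left_mono) auto
    moreover have "4 / real (Suc m) = 4 * (1 / real (Suc m))" by simp
    ultimately show ?thesis
      using g(2)[of k] g(2)[of m] L(2)[of k] by (smt (verit))
  qed
  have lim: "(\<lambda>m. 2 * (L - q m) + 4 / real (Suc m)) \<longlonglongrightarrow> 2 * (L - L) + 4 * 0"
    using LIMSEQ_inverse_real_of_nat by (intro tendsto_intros L(1)) (auto simp: divide_inverse intro!: tendsto_mult_right_zero)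
  have "Cauchy g"
  proof (rule metric_CauchyI)
    fix e :: real assume "e > 0"
    with order_tendstoD(2)[OF lim, of "(e/2)\<^sup>2"]
    obtain N where N: "2 * (L - q N) + 4 / real (Suc N) < (e/2)\<^sup>2"
      by (auto simp: eventually_sequentially)
    have *: "dist (g k) (g N) < e / 2" if "N \<le> k" for k
      using key[OF that] N \<open>e > 0\<close> power2_less_imp_less[of "norm (g k - g N)" "e/2"]
      by (simp add: dist_norm)
    show "\<exists>M. \<forall>m\<ge>M. \<forall>n\<ge>M. dist (g m) (g n) < e"
      using * by (intro exI[of _ N] allI impI) (rule dist_triangle_half_l)
  qed
  then obtain l where "g \<longlonglongrightarrow> l"
    using Cauchy_convergent[of g] by (auto simp: convergent_def)
  with g(1) show ?thesis by (rule that)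
qed

text \<open>
  Closed balls of \<open>H\<close> are closed in \<open>W\<close>, hence \<open>H\<close> is Borel in \<open>W\<close>: along preimages of shrinking
  convex neighbourhoods of a limit point, almost norm-minimal elements converge in \<open>H\<close>.
\<close>

lemma closed_image_cball:
  fixes j :: "'h::{real_inner, complete_space} \<Rightarrow> 'w::frechet_space"
  assumes j: "linear j" "continuous_on UNIV j"
  shows "closed (j ` cball 0 r)"
  unfolding closed_sequential_limits
proof safe
  fix x w assume x: "\<forall>n. x n \<in> j ` cball 0 r" and lim: "x \<longlonglongrightarrow> w"
  interpret linear j by fact
  \<comment> \<open>Convex neighbourhoods pull back under the linear \<open>j\<close> to convex
    sets, as the minimization argument requires; the radii tend to 0, so they pin down the limit
    \<open>w\<close>.\<close>
  have "\<exists>V. open V \<and> 0 \<in> V \<and> V \<subseteq> ball (0::'w) (1 / real (Suc i)) \<and> convex V" for i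
    using locally_convex[of "ball (0::'w) (1 / real (Suc i))"] by (simp add: convex_def)
  then obtain V where V: "\<And>i. open (V i)" "\<And>i. (0::'w) \<in> V i"
    "\<And>i. V i \<subseteq> ball 0 (1 / real (Suc i))" "\<And>i. convex (V i)" by metis
  \<comment> \<open>Intersecting over all \<open>i \<le> m\<close> makes the sets decrease even if
    the \<open>V i\<close> are not nested.\<close>
  define D where "D m = cball 0 r \<inter> (\<Inter>i\<le>m. {h. j h - w \<in> V i})" for m
  have "convex {h. j h - w \<in> V i}" for i
  proof (rule convexI)
    fix h k :: 'h and u v :: real
    assume *: "h \<in> {h. j h - w \<in> V i}" "k \<in> {h. j h - w \<in> V i}" "0 \<le> u" "0 \<le> v" "u + v = 1"
    have "j (u *\<^sub>R h + v *\<^sub>R k) - (u + v) *\<^sub>R w = u *\<^sub>R (j h - w) + v *\<^sub>R (j k - w)"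
      by (simp add: add scale scaleR_diff_right scaleR_add_left)
    then have "j (u *\<^sub>R h + v *\<^sub>R k) - w = u *\<^sub>R (j h - w) + v *\<^sub>R (j k - w)"
      using *(5) by simp
    with convexD[OF V(4)[of i], of "j h - w" "j k - w" u v] *
    show "u *\<^sub>R h + v *\<^sub>R k \<in> {h. j h - w \<in> V i}" by simp
  qed
  then have conv: "convex (D m)" for m
    unfolding D_def by (intro convex_Int convex_INT) auto
  have ne: "D m \<noteq> {}" for m
  proof -
    have "(\<lambda>n. x n - w) \<longlonglongrightarrow> w - w" by (intro tendsto_intros lim)
    then have "eventually (\<lambda>n. x n - w \<in> V i) sequentially" for i
      using V(1,2)[of i] by (auto dest: topological_tendstoD)
    then have "eventually (\<lambda>n. \<forall>i\<in>{..m}. x n - w \<in> V i) sequentially"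
      by (intro eventually_ball_finite) auto
    then obtain n where "\<forall>i\<in>{..m}. x n - w \<in> V i"
      by (auto dest: eventually_happens)
    moreover obtain h where "h \<in> cball 0 r" "x n = j h" using x by blast
    ultimately have "h \<in> D m" by (auto simp: D_def)
    then show ?thesis by blast
  qed
  have dec: "decseq D" by (auto simp: decseq_def D_def)
  have bdd: "bounded (D 0)" unfolding D_def by (intro bounded_Int disjI1 bounded_cball)
  obtain g l where g: "\<And>m. g m \<in> D m" "g \<longlonglongrightarrow> l"
    by (rule decseq_convex_bounded_convergent[OF dec conv ne bdd]) (rule that)
  have "l \<in> cball 0 r"
    by (rule closed_sequentially[OF closed_cball _ g(2)]) (use g(1) in \<open>auto simp: D_def\<close>)
  have "(\<lambda>m. j (g m)) \<longlonglongrightarrow> j l"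
    using j(2) g(2) by (auto simp: continuous_on_eq_continuous_at isCont_tendsto_compose)
  moreover have "(\<lambda>m. j (g m)) \<longlonglongrightarrow> w"
  proof -
    have "dist (j (g m)) w < 1 / real (Suc m)" for m
    proof -
      have "j (g m) - w \<in> V m" using g(1)[of m] by (auto simp: D_def)
      then have "dist 0 (j (g m) - w) < 1 / real (Suc m)" using V(3) by (auto simp: subset_iff)
      then show ?thesis
        using dist_translation_invariant[of 0 w "j (g m) - w"] by (simp add: dist_commute)
    qed
    then show ?thesis by (rule LIMSEQ_dist_less_inverse)
  qed
  ultimately have "j l = w" by (rule LIMSEQ_unique)
  with \<open>l \<in> cball 0 r\<close> show "w \<in> j ` cball 0 r" by blast
qed

text \<open>Sublevel sets at finite levels are images of closed balls of \<open>H\<close>, which are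
  closed in \<open>W\<close>.\<close>

lemma borel_measurable_H_norm:
  fixes j :: "'h::{real_inner, complete_space} \<Rightarrow> 'w::frechet_space"
  assumes j: "linear j" "inj j" "continuous_on UNIV j"
  shows "H_norm j \<in> borel_measurable borel"
proof (rule borel_measurableI_le)
  fix a :: ennreal
  have "{w. H_norm j w \<le> a} \<in> sets borel"
  proof (cases "a = \<top>")
    case False
    then obtain r where r: "a = ennreal r" "0 \<le> r" by (cases a) auto
    have "{w. H_norm j w \<le> a} = j ` cball 0 r"
      using r j(2) by (auto simp: H_norm_def inv_f_f top_unique split: if_splits dest: injD)
    then show ?thesis using closed_image_cball[OF j(1,3)] by (simp add: borel_closed)
  qed auto
  then show "{w \<in> space borel. H_norm j w \<le> a} \<in> sets borel" by simp
qed

lemma H_norm_less_top_iff: "H_norm j w < \<top> \<longleftrightarrow> w \<in> range j"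
  by (auto simp: H_norm_def)

lemma sets_borel_range:
  fixes j :: "'h::{real_inner, complete_space} \<Rightarrow> 'w::frechet_space"
  assumes "linear j" "inj j" "continuous_on UNIV j"
  shows "range j \<in> sets borel"
proof -
  have "{w \<in> space borel. H_norm j w < \<top>} \<in> sets borel"
    using borel_measurable_H_norm[OF assms] by measurable
  then show ?thesis by (simp add: H_norm_less_top_iff)
qed

subsection \<open>A Borel embedding of Polish spaces into the unit interval\<close>

text \<open>Base 3 with digits 0 and 1 only makes the expansion unique: the tail after the first
  digit adds at most 1/6, so each digit can be read back by comparing with 1/3.\<close>

definition ternary_sum :: "(nat \<Rightarrow> bool) \<Rightarrow> real" where
  "ternary_sum b = (\<Sum>n. of_bool (b n) / 3 ^ Suc n)"

primrec ternary_digit :: "nat \<Rightarrow> real \<Rightarrow> bool" where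
  "ternary_digit 0 x \<longleftrightarrow> 1/3 \<le> x"
| "ternary_digit (Suc n) x \<longleftrightarrow> ternary_digit n (3 * x - of_bool (1/3 \<le> x))"

lemma sums_geometric_third: "(\<lambda>n. 1 / 3 ^ Suc n :: real) sums (1/2)"
  using sums_mult[OF geometric_sums[of "1/3::real"], of "1/3"] by (simp add: field_simps)

lemma summable_ternary: "summable (\<lambda>n. of_bool (b n) / 3 ^ Suc n :: real)"
  by (rule summable_comparison_test'[OF sums_summable[OF sums_geometric_third]])
    (auto simp: of_bool_def)

lemma ternary_sum_bounds: "0 \<le> ternary_sum b" "ternary_sum b \<le> 1/2"
proof -
  show "0 \<le> ternary_sum b"
    unfolding ternary_sum_def by (intro suminf_nonneg summable_ternary) auto
  have "ternary_sum b \<le> (\<Sum>n. 1 / 3 ^ Suc n)"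
    unfolding ternary_sum_def
    by (intro suminf_le summable_ternary sums_summable[OF sums_geometric_third]) (auto simp: of_bool_def)
  then show "ternary_sum b \<le> 1/2" using sums_unique[OF sums_geometric_third] by simp
qed

lemma ternary_sum_Suc: "3 * ternary_sum b = of_bool (b 0) + ternary_sum (\<lambda>n. b (Suc n))"
proof -
  have "ternary_sum b = of_bool (b 0) / 3 + (\<Sum>n. of_bool (b (Suc n)) / 3 ^ Suc (Suc n))"
    unfolding ternary_sum_def using suminf_split_head[OF summable_ternary[of b]] by simp
  also have "(\<Sum>n. of_bool (b (Suc n)) / 3 ^ Suc (Suc n) :: real) = ternary_sum (\<lambda>n. b (Suc n)) / 3"
    unfolding ternary_sum_def using suminf_divide[OF summable_ternary[of "\<lambda>n. b (Suc n)"], of 3]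
    by (simp add: field_simps)
  finally show ?thesis by simp
qed

lemma ternary_digit_sum: "ternary_digit n (ternary_sum b) = b n"
proof (induction n arbitrary: b)
  case 0
  show ?case
    using ternary_sum_Suc[of b] ternary_sum_bounds[of "\<lambda>n. b (Suc n)"] by (cases "b 0") auto
next
  case (Suc n)
  have "3 * ternary_sum b - of_bool (1/3 \<le> ternary_sum b) = ternary_sum (\<lambda>n. b (Suc n))"
    using ternary_sum_Suc[of b] ternary_sum_bounds[of "\<lambda>n. b (Suc n)"] by (cases "b 0") auto
  then show ?case using Suc.IH[of "\<lambda>n. b (Suc n)"] by simp
qed

lemma measurable_ternary_digit[measurable]: "Measurable.pred borel (ternary_digit n)"
proof (induction n)
  case (Suc n)
  note Suc.IH[measurable]
  show ?case unfolding ternary_digit.simps by measurable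
qed simp

text \<open>A point is coded by recording which balls of radius \<open>1 / Suc k\<close> about
  points of a countable dense set contain it. Decoding picks, for each \<open>k\<close>, the first
  centre whose ball is marked; on codes of points these centres converge to the point.\<close>

lemma polish_borel_embedding:
  obtains \<phi> :: "'a::polish_space \<Rightarrow> real" and \<psi> :: "real \<Rightarrow> 'a"
  where "\<phi> \<in> borel_measurable borel" "\<psi> \<in> borel_measurable borel"
    "\<And>y. 0 \<le> \<phi> y" "\<And>y. \<phi> y \<le> 1" "\<And>y. \<psi> (\<phi> y) = y"
proof -
  obtain S :: "'a set" where S: "countable S" "\<And>X. open X \<Longrightarrow> X \<noteq> {} \<Longrightarrow> \<exists>d\<in>S. d \<in> X"
    by (rule countable_dense_setE) blast
  have "S \<noteq> {}" using S(2)[of UNIV] by auto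
  define c where "c = from_nat_into S"
  have c: "\<exists>i. y \<in> ball (c i) (1 / real (Suc k))" for y k
  proof -
    obtain d where "d \<in> S" "d \<in> ball y (1 / real (Suc k))" using S(2)[of "ball y (1 / real (Suc k))"] by auto
    moreover obtain i where "c i = d"
      using from_nat_into_surj[OF S(1) \<open>d \<in> S\<close>] by (auto simp: c_def)
    ultimately show ?thesis by (auto simp: dist_commute intro: exI[of _ i])
  qed
  define b where "b y n = (case prod_decode n of (k, i) \<Rightarrow> y \<in> ball (c i) (1 / real (Suc k)))" for y n
  define \<phi> where "\<phi> y = ternary_sum (b y)" for y
  define \<psi>' where "\<psi>' k x = c (LEAST i. ternary_digit (prod_encode (k, i)) x)" for k x
  \<comment> \<open>The constant default \<open>c 0\<close> where the centres are not Cauchy makes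
    the sequence converge everywhere, so that \<open>\<psi>\<close> is a pointwise limit of Borel
    functions.\<close>
  define \<psi> where "\<psi> x = lim (\<lambda>k. if Cauchy (\<lambda>k. \<psi>' k x) then \<psi>' k x else c 0)" for x
  have [measurable]: "Measurable.pred borel (\<lambda>y. b y n)" for n
    unfolding b_def by (cases "prod_decode n") (simp add: pred_def)
  have m\<phi>: "\<phi> \<in> borel_measurable borel"
    unfolding \<phi>_def ternary_sum_def of_bool_def by measurable
  have [measurable]: "\<psi>' k \<in> borel_measurable borel" for k
    unfolding \<psi>'_def by (rule measurable_compose[of _ _ "count_space UNIV"]) measurable
  have m\<psi>: "\<psi> \<in> borel_measurable borel"
  proof (rule borel_measurable_LIMSEQ_metric)
    fix x
    have "convergent (\<lambda>k. if Cauchy (\<lambda>k. \<psi>' k x) then \<psi>' k x else c 0)"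
      by (cases "Cauchy (\<lambda>k. \<psi>' k x)") (auto intro: Cauchy_convergent convergent_const)
    then show "(\<lambda>k. if Cauchy (\<lambda>k. \<psi>' k x) then \<psi>' k x else c 0) \<longlonglongrightarrow> \<psi> x"
      unfolding \<psi>_def by (rule convergent_LIMSEQ_iff[THEN iffD1])
  qed measurable
  have inv: "\<psi> (\<phi> y) = y" for y
  proof -
    have "dist (\<psi>' k (\<phi> y)) y < 1 / real (Suc k)" for k
    proof -
      have "\<psi>' k (\<phi> y) = c (LEAST i. y \<in> ball (c i) (1 / real (Suc k)))"
        by (simp add: \<psi>'_def \<phi>_def ternary_digit_sum b_def)
      then show ?thesis using LeastI_ex[OF c[of y k]] by simp
    qed
    then have "(\<lambda>k. \<psi>' k (\<phi> y)) \<longlonglongrightarrow> y"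
      by (rule LIMSEQ_dist_less_inverse)
    then show ?thesis
      unfolding \<psi>_def using LIMSEQ_imp_Cauchy[of "\<lambda>k. \<psi>' k (\<phi> y)" y] by (simp add: limI)
  qed
  show ?thesis
    using m\<phi> m\<psi> ternary_sum_bounds inv
    by (intro that[of \<phi> \<psi>]) (auto simp: \<phi>_def intro: order_trans[OF ternary_sum_bounds(2)])
qed

subsection \<open>Realizing couplings by maps\<close>

text \<open>Probability integral transform: without atoms the distribution function is continuous,
  so if the level \<open>a\<close> is crossed, the sublevel set is the open ray below a point
  \<open>s\<close> at which the value is exactly \<open>a\<close>.\<close>

lemma (in real_distribution) measure_cdf_less:
  assumes atomless: "\<And>x. measure M {x} = 0" and a: "0 \<le> a" "a \<le> 1"
  shows "measure M {x. cdf M x < a} = a"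
proof -
  have cont: "isCont (cdf M) x" for x using atomless by (simp add: isCont_cdf)
  have mono: "cdf M x \<le> cdf M y" if "x \<le> y" for x y using that by (rule cdf_nondecreasing)
  \<comment> \<open>If \<open>a\<close> is not crossed, the limits of the distribution function at
    minus or plus infinity force \<open>a = 0\<close> or \<open>a = 1\<close>.\<close>
  consider "{x. cdf M x < a} = {}" | "{x. cdf M x < a} = UNIV" |
    x y where "cdf M x < a" "a \<le> cdf M y"
    by (cases "\<exists>x. cdf M x < a"; cases "\<exists>y. a \<le> cdf M y") (auto simp: not_less not_le)
  then show ?thesis
  proof cases
    case 1
    then have "a \<le> cdf M x" for x by (auto simp: not_less)
    then have "a \<le> 0"
      by (intro tendsto_lowerbound[OF cdf_lim_at_bot]) auto
    with 1 a show ?thesis by simp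
  next
    case 2
    then have "cdf M x \<le> a" for x using less_imp_le by blast
    then have "1 \<le> a"
      by (intro tendsto_upperbound[OF cdf_lim_at_top_prob]) auto
    with 2 a prob_space show ?thesis by simp
  next
    case (3 x y)
    then have "x \<le> y" using mono[of y x] by linarith
    define s where "s = Sup {x. cdf M x < a}"
    have bdd: "bdd_above {x. cdf M x < a}"
    proof (intro bdd_aboveI[of _ y])
      fix z assume "z \<in> {x. cdf M x < a}"
      then show "z \<le> y" using 3(2) mono[of y z] by (cases "z \<le> y") auto
    qed
    have op: "open {x. cdf M x < a}"
      using cont by (intro open_Collect_less continuous_intros) (auto intro: continuous_at_imp_continuous_on)
    have *: "cdf M z < a" if "z < s" for z
    proof -
      obtain x' where "cdf M x' < a" "z < x'"
        using less_cSup_iff[OF _ bdd, of z] 3(1) \<open>z < s\<close> unfolding s_def by blast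
      then show ?thesis using mono[of z x'] by simp
    qed
    have "a \<le> cdf M s"
    proof (rule ccontr)
      assume "\<not> ?thesis"
      then obtain e where "e > 0" "ball s e \<subseteq> {x. cdf M x < a}"
        using op by (metis mem_Collect_eq not_le open_contains_ball)
      then have "s + e / 2 \<in> {x. cdf M x < a}" by (auto simp: dist_real_def subset_iff)
      from cSup_upper[OF this bdd] \<open>e > 0\<close> show False by (simp add: s_def)
    qed
    moreover have "cdf M s \<le> a"
    proof (rule tendsto_upperbound)
      show "(cdf M \<longlongrightarrow> cdf M s) (at_left s)"
        using cont[of s] unfolding isCont_def by (rule filterlim_mono) (auto simp: at_le)
      show "eventually (\<lambda>z. cdf M z \<le> a) (at_left s)"
        using * by (auto simp: eventually_at_filter less_imp_le)
    qed simp
    ultimately have "cdf M s = a" by simp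
    have "{x. cdf M x < a} = {..s} - {s}"
    proof safe
      fix z assume "cdf M z < a"
      then show "z \<le> s" using \<open>a \<le> cdf M s\<close> mono[of s z] by (cases "z \<le> s") auto
    next
      fix z assume "z \<le> s" "z \<noteq> s"
      then show "cdf M z < a" using * by simp
    qed (use \<open>a \<le> cdf M s\<close> in auto)
    then have "measure M {x. cdf M x < a} = measure M {..s} - measure M {s}"
      by (simp add: finite_measure_Diff)
    with \<open>cdf M s = a\<close> atomless show ?thesis by (simp add: cdf_def)
  qed
qed

section \<open>Comparison of densities and of joint laws\<close>

text \<open>Test with the set where \<open>g < f\<close>: the difference has integral zero there.
  Finiteness of the integral of \<open>g\<close> permits the subtraction.\<close>

lemma AE_le_of_nn_integral_le:
  assumes [measurable]: "f \<in> borel_measurable M" "g \<in> borel_measurable M"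
    and fin: "(\<integral>\<^sup>+x. g x \<partial>M) < \<infinity>"
    and le: "\<And>A. A \<in> sets M \<Longrightarrow> (\<integral>\<^sup>+x. f x * indicator A x \<partial>M) \<le> (\<integral>\<^sup>+x. g x * indicator A x \<partial>M)"
  shows "AE x in M. f x \<le> g x"
proof -
  define A where "A = {x \<in> space M. g x < f x}"
  have [measurable]: "A \<in> sets M" unfolding A_def by measurable
  have finA: "(\<integral>\<^sup>+x. g x * indicator A x \<partial>M) < \<infinity>"
    using fin by (rule le_less_trans[rotated]) (auto intro!: nn_integral_mono simp: indicator_def)
  have "(\<integral>\<^sup>+x. f x * indicator A x - g x * indicator A x \<partial>M) =
      (\<integral>\<^sup>+x. f x * indicator A x \<partial>M) - (\<integral>\<^sup>+x. g x * indicator A x \<partial>M)"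
    using finA by (intro nn_integral_diff) (auto simp: A_def indicator_def)
  also have "\<dots> = 0" using le[of A] le_less_trans[OF le[of A] finA] by (simp add: diff_eq_0_iff_ennreal)
  finally have "AE x in M. f x * indicator A x - g x * indicator A x = 0"
    by (simp add: nn_integral_0_iff_AE)
  then show ?thesis
    by (rule AE_mp) (auto simp: A_def indicator_def diff_eq_0_iff_ennreal not_le split: if_splits)
qed

lemma emeasure_distr_density_indicator:
  assumes [measurable]: "S \<in> sets M" "f \<in> M \<rightarrow>\<^sub>M N" "B \<in> sets N"
  shows "emeasure (distr (density M (indicator S)) N f) B = emeasure M {w \<in> space M. w \<in> S \<and> f w \<in> B}"
proof -
  have "emeasure (distr (density M (indicator S)) N f) B =
      (\<integral>\<^sup>+w. indicator S w * indicator (f -` B \<inter> space M) w \<partial>M)"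
    by (subst emeasure_distr) (auto simp: emeasure_density)
  also have "\<dots> = (\<integral>\<^sup>+w. indicator {w \<in> space M. w \<in> S \<and> f w \<in> B} w \<partial>M)"
    by (intro nn_integral_cong) (auto simp: indicator_def)
  finally show ?thesis by simp
qed

lemma measure_eqI_pair:
  assumes sets: "sets \<mu> = sets (M \<Otimes>\<^sub>M N)" "sets \<nu> = sets (M \<Otimes>\<^sub>M N)" and "finite_measure \<mu>"
    and eq: "\<And>A B. A \<in> sets M \<Longrightarrow> B \<in> sets N \<Longrightarrow> emeasure \<mu> (A \<times> B) = emeasure \<nu> (A \<times> B)"
  shows "\<mu> = \<nu>"
proof (rule measure_eqI_generator_eq[OF Int_stable_pair_measure_generator[of M N], where A="\<lambda>_. space M \<times> space N"])
  interpret finite_measure \<mu> by fact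
  show "emeasure \<mu> (space M \<times> space N) \<noteq> \<infinity>" by simp
  show "{a \<times> b |a b. a \<in> sets M \<and> b \<in> sets N} \<subseteq> Pow (space M \<times> space N)"
    by (rule pair_measure_closed)
  show "sets \<mu> = sigma_sets (space M \<times> space N) {a \<times> b |a b. a \<in> sets M \<and> b \<in> sets N}"
    "sets \<nu> = sigma_sets (space M \<times> space N) {a \<times> b |a b. a \<in> sets M \<and> b \<in> sets N}"
    by (simp_all add: sets sets_pair_measure)
qed (use eq in auto)

text \<open>
  \<open>U\<close> is uniformly distributed on the unit interval and independent of \<open>f\<close>, expressed through
  random thresholds \<open>h \<circ> f\<close>.
\<close>

definition uniform_given :: "'a measure \<Rightarrow> 'b measure \<Rightarrow> ('a \<Rightarrow> 'b) \<Rightarrow> ('a \<Rightarrow> ennreal) \<Rightarrow> bool" where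
  "uniform_given M N f U \<longleftrightarrow> U \<in> borel_measurable M \<and>
     (\<forall>A\<in>sets N. \<forall>h\<in>borel_measurable N. (\<forall>x. h x \<le> 1) \<longrightarrow>
        emeasure M {w \<in> space M. f w \<in> A \<and> U w < h (f w)} = (\<integral>\<^sup>+x\<in>A. h x \<partial>distr M N f))"

section \<open>Sampling by conditional quantiles\<close>

text \<open>The conditional tail probabilities of \<open>Z\<close> given \<open>X\<close> are
  obtained as Radon-Nikodym densities and regularized along rational levels; inverting them at the
  uniform variable \<open>U\<close> gives \<open>T\<close>. The joint laws are then compared on
  half-lines for each fixed \<open>A\<close>.\<close>

lemma realize_real_coupling:
  fixes U :: "'a \<Rightarrow> ennreal" and Z :: "'c \<Rightarrow> real"
  assumes M: "prob_space M" "prob_space \<Omega>"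
    and [measurable]: "f \<in> M \<rightarrow>\<^sub>M N" "X \<in> \<Omega> \<rightarrow>\<^sub>M N" "Z \<in> borel_measurable \<Omega>"
    and eq: "distr M N f = distr \<Omega> N X"
    and Z: "\<And>\<omega>. 0 \<le> Z \<omega>" "\<And>\<omega>. Z \<omega> \<le> 1"
    and unif: "uniform_given M N f U"
  shows "\<exists>T\<in>borel_measurable M.
    distr M (N \<Otimes>\<^sub>M borel) (\<lambda>w. (f w, T w)) = distr \<Omega> (N \<Otimes>\<^sub>M borel) (\<lambda>\<omega>. (X \<omega>, Z \<omega>))"
proof -
  interpret M: prob_space M by fact
  interpret \<Omega>: prob_space \<Omega> by fact
  have [measurable]: "U \<in> borel_measurable M" using unif by (simp add: uniform_given_def)
  define \<mu> where "\<mu> = distr M N f"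
  interpret \<mu>: prob_space \<mu> unfolding \<mu>_def by (rule M.prob_space_distr) measurable
  have [measurable_cong, simp]: "sets \<mu> = sets N" and [simp]: "space \<mu> = space N" by (simp_all add: \<mu>_def)
  define P where "P r A = emeasure \<Omega> {\<omega> \<in> space \<Omega>. r < Z \<omega> \<and> X \<omega> \<in> A}" for r A
  \<comment> \<open>For fixed \<open>r\<close> the set function \<open>P r\<close> is a measure
    dominated by \<open>\<mu>\<close>, the common law of \<open>f\<close> and \<open>X\<close>, so
    it has a density.\<close>
  have "\<exists>h\<in>borel_measurable N. \<forall>A\<in>sets N. (\<integral>\<^sup>+x. h x * indicator A x \<partial>\<mu>) = P r A" for r
  proof -
    define L where "L = distr (density \<Omega> (indicator {\<omega> \<in> space \<Omega>. r < Z \<omega>})) N X"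
    have L: "emeasure L A = P r A" if [measurable]: "A \<in> sets N" for A
      unfolding L_def P_def
      by (subst emeasure_distr_density_indicator) (auto intro!: arg_cong[where f="emeasure \<Omega>"])
    have "absolutely_continuous \<mu> L"
      unfolding absolutely_continuous_def
    proof
      fix A assume A: "A \<in> null_sets \<mu>"
      then have [measurable]: "A \<in> sets N" and "emeasure \<mu> A = 0" by auto
      have "P r A \<le> emeasure \<Omega> (X -` A \<inter> space \<Omega>)" unfolding P_def by (intro emeasure_mono) auto
      also have "\<dots> = emeasure \<mu> A" unfolding \<mu>_def eq by (simp add: emeasure_distr)
      finally show "A \<in> null_sets L" using L[of A] A by (simp add: null_sets_def L_def)
    qed
    then obtain h where "h \<in> borel_measurable \<mu>" "density \<mu> h = L"
      using \<mu>.Radon_Nikodym[of L] by (auto simp: L_def)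
    then show ?thesis using L emeasure_density[of h \<mu>] by (intro bexI[of _ h]) auto
  qed
  then obtain h where [measurable]: "\<And>r. h r \<in> borel_measurable N"
    and h: "\<And>r A. A \<in> sets N \<Longrightarrow> (\<integral>\<^sup>+x. h r x * indicator A x \<partial>\<mu>) = P r A"
    by metis
  have P_mono: "P q A \<le> P r A" if [measurable]: "A \<in> sets N" and "r \<le> q" for q r A
    unfolding P_def using that(2) by (intro emeasure_mono) auto
  have h_mono: "AE x in \<mu>. h q x \<le> h r x" if "r \<le> q" for q r
  proof (rule AE_le_of_nn_integral_le)
    have "(\<integral>\<^sup>+x. h r x \<partial>\<mu>) = (\<integral>\<^sup>+x. h r x * indicator (space N) x \<partial>\<mu>)"
      by (intro nn_integral_cong) auto
    also have "\<dots> = P r (space N)" by (rule h) simp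
    also have "\<dots> < \<infinity>" unfolding P_def by (simp add: less_top[symmetric])
    finally show "(\<integral>\<^sup>+x. h r x \<partial>\<mu>) < \<infinity>" .
  qed (use P_mono that in \<open>auto simp: h\<close>)
  have P_le: "P r A \<le> emeasure \<mu> A" if [measurable]: "A \<in> sets N" for r A
    unfolding P_def \<mu>_def eq by (subst emeasure_distr) (auto intro!: emeasure_mono)
  have h_le: "AE x in \<mu>. h r x \<le> 1" for r
    using P_le \<mu>.emeasure_finite[of "space N"]
    by (intro AE_le_of_nn_integral_le) (auto simp: h less_top[symmetric])
  \<comment> \<open>Countability lets the almost-sure inequalities between the \<open>h q\<close>
    hold simultaneously; 0 is included so that the supremum defining \<open>T\<close> is over a
    nonempty set.\<close>
  define I :: "real set" where "I = \<rat> \<inter> {0..1}"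
  have I: "countable I" "0 \<in> I" "I \<subseteq> {0..1}"
    by (auto simp: I_def countable_rat intro: countable_subset[OF _ countable_rat])
  define Q where "Q r = {q \<in> I. r < q}" for r
  have [simp]: "countable (Q r)" for r using I(1) by (auto simp: Q_def)
  \<comment> \<open>Levels strictly above \<open>r\<close> give right-continuity in
    \<open>r\<close>; the cap at 1 makes \<open>g r\<close> an admissible threshold for
    \<open>uniform_given\<close> everywhere, not only almost everywhere.\<close>
  define g where "g r x = (SUP q\<in>Q r. min 1 (h q x))" for r x
  have g_meas[measurable]: "g r \<in> borel_measurable N" for r
    unfolding g_def by measurable
  have g_le: "g r x \<le> 1" for r x unfolding g_def by (intro SUP_least) simp
  \<comment> \<open>Right-continuity of \<open>P\<close> in the level: the event
    \<open>Z > r\<close> is the increasing union of the events \<open>Z > r + 1 / Suc n\<close>,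
    each inside \<open>Z > q\<close> for some \<open>q\<close> in \<open>Q r\<close>. For
    \<open>r \<ge> 1\<close> there is no such level, but the event is empty since
    \<open>Z \<le> 1\<close>.\<close>
  have P_cont: "P r A \<le> c" if A[measurable]: "A \<in> sets N" and "0 \<le> r" and c: "\<And>q. q \<in> Q r \<Longrightarrow> P q A \<le> c" for r A c
  proof (cases "r < 1")
    case False
    then have "\<not> r < Z \<omega>" for \<omega> using Z(2)[of \<omega>] by linarith
    then show ?thesis by (simp add: P_def)
  next
    case True
    have "\<exists>q. q \<in> Q r \<and> q < r + 1 / real (Suc n)" for n
    proof -
      have "r < min 1 (r + 1 / real (Suc n))" using True by simp
      from Rats_dense_in_real[OF this] obtain q where "q \<in> \<rat>" "r < q" "q < min 1 (r + 1 / real (Suc n))" by blast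
      then show ?thesis using \<open>0 \<le> r\<close> by (intro exI[of _ q]) (auto simp: Q_def I_def)
    qed
    then obtain q where q: "q n \<in> Q r" "q n < r + 1 / real (Suc n)" for n by metis
    define S where "S n = {\<omega> \<in> space \<Omega>. r + 1 / real (Suc n) < Z \<omega> \<and> X \<omega> \<in> A}" for n
    have "incseq S"
    proof (rule incseq_SucI)
      fix n
      have "1 / real (Suc (Suc n)) \<le> 1 / real (Suc n)" by (simp add: frac_le)
      then have "r + 1 / real (Suc (Suc n)) < z" if "r + 1 / real (Suc n) < z" for z
        using that by linarith
      then show "S n \<subseteq> S (Suc n)" unfolding S_def by blast
    qed
    have "{\<omega> \<in> space \<Omega>. r < Z \<omega> \<and> X \<omega> \<in> A} = (\<Union>n. S n)"
    proof (intro set_eqI iffI)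
      fix \<omega> assume *: "\<omega> \<in> {\<omega> \<in> space \<Omega>. r < Z \<omega> \<and> X \<omega> \<in> A}"
      then obtain n where "1 / real (Suc n) < Z \<omega> - r" using nat_approx_posE[of "Z \<omega> - r"] by auto
      then show "\<omega> \<in> (\<Union>n. S n)" using * by (auto simp: S_def intro!: exI[of _ n])
    next
      fix \<omega> assume "\<omega> \<in> (\<Union>n. S n)"
      then obtain n where n: "\<omega> \<in> S n" by blast
      have "r < r + 1 / real (Suc n)" by simp
      with n show "\<omega> \<in> {\<omega> \<in> space \<Omega>. r < Z \<omega> \<and> X \<omega> \<in> A}"
        unfolding S_def mem_Collect_eq by (blast intro: less_trans)
    qed
    then have "P r A = emeasure \<Omega> (\<Union>n. S n)" by (simp add: P_def)
    also have "\<dots> = (SUP n. emeasure \<Omega> (S n))"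
    proof (rule SUP_emeasure_incseq[symmetric, OF _ \<open>incseq S\<close>])
      have "S n \<in> sets \<Omega>" for n unfolding S_def by measurable
      then show "range S \<subseteq> sets \<Omega>" by blast
    qed
    also have "\<dots> \<le> c"
    proof (rule SUP_least)
      fix n
      have "emeasure \<Omega> (S n) \<le> P (q n) A"
        unfolding P_def S_def using q(2)[of n] by (intro emeasure_mono) auto
      with c[OF q(1)[of n]] show "emeasure \<Omega> (S n) \<le> c" by simp
    qed
    finally show ?thesis .
  qed
  \<comment> \<open>Passing from \<open>h\<close> to \<open>g\<close> keeps the integrals:
    monotonicity in the level gives one inequality, right-continuity of \<open>P\<close> the
    other.\<close>
  have g_int: "(\<integral>\<^sup>+x. g r x * indicator A x \<partial>\<mu>) = P r A" if A[measurable]: "A \<in> sets N" and "0 \<le> r" for r A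
  proof (rule antisym)
    have "AE x in \<mu>. \<forall>q\<in>Q r. h q x \<le> h r x"
      by (subst AE_ball_countable, simp, intro ballI h_mono) (simp add: Q_def)
    then have "AE x in \<mu>. g r x * indicator A x \<le> h r x * indicator A x"
      by eventually_elim
        (auto simp: g_def split: split_indicator intro!: SUP_least min.coboundedI2)
    then have "(\<integral>\<^sup>+x. g r x * indicator A x \<partial>\<mu>) \<le> (\<integral>\<^sup>+x. h r x * indicator A x \<partial>\<mu>)"
      by (rule nn_integral_mono_AE)
    then show "(\<integral>\<^sup>+x. g r x * indicator A x \<partial>\<mu>) \<le> P r A" using h[OF A] by simp
    show "P r A \<le> (\<integral>\<^sup>+x. g r x * indicator A x \<partial>\<mu>)"
    proof (rule P_cont[OF A \<open>0 \<le> r\<close>])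
      fix q assume q: "q \<in> Q r"
      have "P q A = (\<integral>\<^sup>+x. h q x * indicator A x \<partial>\<mu>)" using h[OF A] by simp
      also have "\<dots> \<le> (\<integral>\<^sup>+x. g r x * indicator A x \<partial>\<mu>)"
      proof (rule nn_integral_mono_AE)
        show "AE x in \<mu>. h q x * indicator A x \<le> g r x * indicator A x"
          using h_le[of q]
        proof eventually_elim
          case (elim x)
          then have "h q x = min 1 (h q x)" by simp
          also have "\<dots> \<le> g r x" unfolding g_def using q by (rule SUP_upper)
          finally show ?case by (auto simp: indicator_def)
        qed
      qed
      finally show "P q A \<le> (\<integral>\<^sup>+x. g r x * indicator A x \<partial>\<mu>)" .
    qed
  qed
  (* h q x is the conditional probability of Z > q given X = x, so T w is a conditional quantile. *)
  define T where "T w = (SUP q\<in>I. if U w < min 1 (h q (f w)) then q else 0)" for w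
  have bdd: "bdd_above ((\<lambda>q. if U w < min 1 (h q (f w)) then q else 0) ` I)" for w
    using I(3) by (intro bdd_aboveI[of _ 1]) auto
  have T_nonneg: "0 \<le> T w" for w
  proof -
    have "0 \<le> (if U w < min 1 (h 0 (f w)) then 0 else (0::real))" by simp
    also have "\<dots> \<le> T w" unfolding T_def by (rule cSUP_upper[OF I(2) bdd])
    finally show ?thesis .
  qed
  \<comment> \<open>A supremum strictly exceeds a value exactly when one of its terms does;
    \<open>r \<ge> 0\<close> excludes the default value 0 as such a term.\<close>
  have T_greater: "r < T w \<longleftrightarrow> U w < g r (f w)" if "0 \<le> r" for r w
  proof -
    have "r < T w \<longleftrightarrow> (\<exists>q\<in>I. r < (if U w < min 1 (h q (f w)) then q else 0))"
      unfolding T_def using I(2) bdd by (intro less_cSUP_iff) auto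
    also have "\<dots> \<longleftrightarrow> (\<exists>q\<in>Q r. U w < min 1 (h q (f w)))"
      using that by (auto simp: Q_def split: if_splits)
    also have "\<dots> \<longleftrightarrow> U w < g r (f w)" unfolding g_def less_SUP_iff by (rule refl)
    finally show ?thesis .
  qed
  have T_meas[measurable]: "T \<in> borel_measurable M"
  proof (rule borel_measurableI_greater)
    fix r
    show "{w \<in> space M. r < T w} \<in> sets M"
    proof (cases "0 \<le> r")
      case True
      then show ?thesis by (simp add: T_greater)
    next
      case False
      then have "{w \<in> space M. r < T w} = space M" using less_le_trans[OF _ T_nonneg, of r] by (auto simp: not_le)
      then show ?thesis by simp
    qed
  qed
  have joint: "emeasure M {w \<in> space M. f w \<in> A \<and> T w \<in> B} = emeasure \<Omega> {\<omega> \<in> space \<Omega>. X \<omega> \<in> A \<and> Z \<omega> \<in> B}"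
    if [measurable]: "A \<in> sets N" "B \<in> sets borel" for A B
  proof -
    \<comment> \<open>Restricting to the event that the first component lies in \<open>A\<close>
      leaves finite measures on the line, which are determined by half-lines.\<close>
    define M1 where "M1 = distr (density M (indicator (f -` A \<inter> space M))) borel T"
    define M2 where "M2 = distr (density \<Omega> (indicator (X -` A \<inter> space \<Omega>))) borel Z"
    have M1: "emeasure M1 B = emeasure M {w \<in> space M. f w \<in> A \<and> T w \<in> B}" if [measurable]: "B \<in> sets borel" for B
      unfolding M1_def by (subst emeasure_distr_density_indicator) (auto intro!: arg_cong[where f="emeasure M"])
    have M2: "emeasure M2 B = emeasure \<Omega> {\<omega> \<in> space \<Omega>. X \<omega> \<in> A \<and> Z \<omega> \<in> B}" if [measurable]: "B \<in> sets borel" for B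
      unfolding M2_def by (subst emeasure_distr_density_indicator) (auto intro!: arg_cong[where f="emeasure \<Omega>"])
    have "M1 = M2"
    proof (rule measure_eqI_lessThan)
      show "sets M1 = sets borel" "sets M2 = sets borel" by (simp_all add: M1_def M2_def)
      fix r :: real
      show "emeasure M1 {r<..} < \<infinity>" by (simp add: M1 less_top[symmetric])
      show "emeasure M1 {r<..} = emeasure M2 {r<..}"
      proof (cases "0 \<le> r")
        case True
        have "emeasure M1 {r<..} = emeasure M {w \<in> space M. f w \<in> A \<and> U w < g r (f w)}"
          using True by (simp add: M1 T_greater)
        also have "\<dots> = P r A"
          using unif g_le g_int[OF _ True] by (simp add: uniform_given_def \<mu>_def)
        also have "\<dots> = emeasure M2 {r<..}"
          by (simp add: M2 P_def conj_commute)
        finally show ?thesis .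
      next
        case False
        \<comment> \<open>Since \<open>T\<close> and \<open>Z\<close> are nonnegative, the half-line
          carries the full mass, and only the laws of \<open>f\<close> and \<open>X\<close> are
          compared.\<close>
        then have "r < T w" "r < Z \<omega>" for w \<omega> using T_nonneg[of w] Z(1)[of \<omega>] by linarith+
        then have "emeasure M1 {r<..} = emeasure \<mu> A" "emeasure M2 {r<..} = emeasure (distr \<Omega> N X) A"
          by (simp_all add: M1 M2 \<mu>_def emeasure_distr vimage_def Int_def conj_commute)
        then show ?thesis by (simp add: \<mu>_def eq)
      qed
    qed
    then show ?thesis using M1[of B] M2[of B] by simp
  qed
  have "distr M (N \<Otimes>\<^sub>M borel) (\<lambda>w. (f w, T w)) = distr \<Omega> (N \<Otimes>\<^sub>M borel) (\<lambda>\<omega>. (X \<omega>, Z \<omega>))"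
  proof (rule measure_eqI_pair)
    show "finite_measure (distr M (N \<Otimes>\<^sub>M borel) (\<lambda>w. (f w, T w)))"
      by (intro M.finite_measure_distr) measurable
    fix A B assume [measurable]: "A \<in> sets N" "B \<in> sets (borel :: real measure)"
    show "emeasure (distr M (N \<Otimes>\<^sub>M borel) (\<lambda>w. (f w, T w))) (A \<times> B) =
      emeasure (distr \<Omega> (N \<Otimes>\<^sub>M borel) (\<lambda>\<omega>. (X \<omega>, Z \<omega>))) (A \<times> B)"
      using joint[of A B] by (simp add: emeasure_distr vimage_def Int_def conj_commute)
  qed simp_all
  with T_meas show ?thesis by blast
qed

text \<open>Embed the target into the unit interval, realize the coupling there and decode; decoding
  undoes the embedding on the values of \<open>Y\<close>, so the joint law is as required.\<close>

lemma realize_coupling: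
  fixes U :: "'a \<Rightarrow> ennreal" and Y :: "'c \<Rightarrow> 'b::polish_space"
  assumes M: "prob_space M" "prob_space \<Omega>"
    and [measurable]: "f \<in> M \<rightarrow>\<^sub>M N" "X \<in> \<Omega> \<rightarrow>\<^sub>M N" "Y \<in> borel_measurable \<Omega>"
    and eq: "distr M N f = distr \<Omega> N X"
    and unif: "uniform_given M N f U"
  shows "\<exists>T\<in>borel_measurable M.
    distr M (N \<Otimes>\<^sub>M borel) (\<lambda>w. (f w, T w)) = distr \<Omega> (N \<Otimes>\<^sub>M borel) (\<lambda>\<omega>. (X \<omega>, Y \<omega>))"
proof -
  obtain \<phi> :: "'b \<Rightarrow> real" and \<psi> where
    [measurable]: "\<phi> \<in> borel_measurable borel" "\<psi> \<in> borel_measurable borel"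
    and \<phi>: "\<And>y. 0 \<le> \<phi> y" "\<And>y. \<phi> y \<le> 1" "\<And>y. \<psi> (\<phi> y) = y"
    by (rule polish_borel_embedding) (rule that)
  have "\<exists>T\<in>borel_measurable M.
    distr M (N \<Otimes>\<^sub>M borel) (\<lambda>w. (f w, T w)) = distr \<Omega> (N \<Otimes>\<^sub>M borel) (\<lambda>\<omega>. (X \<omega>, \<phi> (Y \<omega>)))"
    by (rule realize_real_coupling[OF M _ _ _ eq \<phi>(1,2) unif]) measurable
  then obtain T where [measurable]: "T \<in> borel_measurable M"
    and T: "distr M (N \<Otimes>\<^sub>M borel) (\<lambda>w. (f w, T w)) = distr \<Omega> (N \<Otimes>\<^sub>M borel) (\<lambda>\<omega>. (X \<omega>, \<phi> (Y \<omega>)))"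
    by blast
  let ?g = "\<lambda>z. (fst z, \<psi> (snd z))"
  have "distr M (N \<Otimes>\<^sub>M borel) (\<lambda>w. (f w, \<psi> (T w))) =
      distr (distr M (N \<Otimes>\<^sub>M borel) (\<lambda>w. (f w, T w))) (N \<Otimes>\<^sub>M borel) ?g"
    by (subst distr_distr) (auto simp: comp_def)
  also have "\<dots> = distr \<Omega> (N \<Otimes>\<^sub>M borel) (\<lambda>\<omega>. (X \<omega>, Y \<omega>))"
    unfolding T by (subst distr_distr) (auto simp: comp_def \<phi>)
  finally show ?thesis by (intro bexI[of _ "\<lambda>w. \<psi> (T w)"]) measurable
qed

subsection \<open>Uniform variables from spread measures\<close>

text \<open>For a basic open set \<open>b\<close>, the event that \<open>f\<close> lies both in
  \<open>b\<close> and outside it is empty, so for almost every \<open>x\<close> in \<open>b\<close>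
  the kernel gives no mass to the points that \<open>f\<close> maps outside \<open>b\<close>. A
  countable base handles all \<open>b\<close> at once and separates points.\<close>

lemma regular_conditional_prob_fibre:
  fixes m :: "'w::polish_space measure"
  assumes m[measurable_cong]: "sets m = sets borel" and [measurable]: "f \<in> borel_measurable borel"
    and \<kappa>: "regular_conditional_prob m f \<kappa>"
  shows "AE x in distr m borel f. AE w in \<kappa> x. f w = x"
proof -
  have [measurable]: "\<kappa> \<in> borel \<rightarrow>\<^sub>M prob_algebra borel"
    and cond: "\<And>A B. A \<in> sets borel \<Longrightarrow> B \<in> sets borel \<Longrightarrow>
      emeasure m (A \<inter> f -` B) = (\<integral>\<^sup>+x\<in>B. emeasure (\<kappa> x) A \<partial>distr m borel f)"
    using \<kappa> by (auto simp: regular_conditional_prob_def)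
  have sets_\<kappa>[measurable_cong]: "sets (\<kappa> x) = sets borel" for x
    using measurable_space[of \<kappa> borel "prob_algebra borel" x] by (auto simp: space_prob_algebra)
  note [measurable] = measurable_prob_algebraD[OF \<open>\<kappa> \<in> borel \<rightarrow>\<^sub>M prob_algebra borel\<close>]
  obtain B :: "'w set set" where B: "countable B" "topological_basis B"
    using ex_countable_basis[where 'a='w] by blast
  have B_sets: "b \<in> sets borel" if "b \<in> B" for b
    using topological_basis_open[OF B(2) that] by (rule borel_open)
  have "AE x in distr m borel f. \<forall>b\<in>B. x \<in> b \<longrightarrow> (AE w in \<kappa> x. f w \<in> b)"
  proof (subst AE_ball_countable[OF B(1)], rule ballI)
    fix b assume "b \<in> B"
    then have [measurable]: "b \<in> sets borel" by (rule B_sets)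
    have [measurable]: "f -` (- b) \<in> sets borel"
      using measurable_sets[of f borel borel "- b"] by simp
    have "(\<integral>\<^sup>+x\<in>b. emeasure (\<kappa> x) (f -` (- b)) \<partial>distr m borel f) = 0"
      using cond[of "f -` (- b)" b] by (simp flip: vimage_Int)
    then have "AE x in distr m borel f. emeasure (\<kappa> x) (f -` (- b)) * indicator b x = 0"
      by (subst (asm) nn_integral_0_iff_AE) auto
    then show "AE x in distr m borel f. x \<in> b \<longrightarrow> (AE w in \<kappa> x. f w \<in> b)"
    proof eventually_elim
      case (elim x)
      show ?case
      proof
        assume "x \<in> b"
        with elim have "f -` (- b) \<in> null_sets (\<kappa> x)" by (auto simp: null_sets_def sets_\<kappa>)
        then show "AE w in \<kappa> x. f w \<in> b" by (rule AE_I') auto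
      qed
    qed
  qed
  then show ?thesis
  proof eventually_elim
    case (elim x)
    then have "AE w in \<kappa> x. \<forall>b\<in>{b\<in>B. x \<in> b}. f w \<in> b"
      using B(1) by (subst AE_ball_countable) auto
    then show ?case
    proof eventually_elim
      case (elim w)
      show ?case
      proof (rule ccontr)
        assume "f w \<noteq> x"
        then obtain V where "open V" "x \<in> V" "f w \<notin> V" using t1_space[of x "f w"] by auto
        then obtain b where "b \<in> B" "x \<in> b" "b \<subseteq> V" using topological_basisE[OF B(2)] by metis
        with elim \<open>f w \<notin> V\<close> show False by blast
      qed
    qed
  qed
qed

text \<open>\<open>U w\<close> is the conditional distribution function of \<open>t\<close> given
  \<open>f = f w\<close>, evaluated at \<open>t w\<close>. The probability integral transform
  applies under almost every \<open>\<kappa> x\<close>, and integrating over \<open>A\<close> gives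
  the claim.\<close>

lemma conditional_uniform:
  fixes m :: "'w::polish_space measure" and t :: "'w \<Rightarrow> real"
  assumes m[measurable_cong]: "sets m = sets borel" and f[measurable]: "f \<in> borel_measurable borel"
    and t[measurable]: "t \<in> borel_measurable borel"
    and \<kappa>: "regular_conditional_prob m f \<kappa>"
    and atomless: "AE x in distr m borel f. \<forall>s. emeasure (\<kappa> x) {w. f w = x \<and> t w = s} = 0"
  obtains U where "uniform_given m borel f U"
proof -
  have \<kappa>_meas[measurable]: "\<kappa> \<in> borel \<rightarrow>\<^sub>M prob_algebra borel"
    and cond: "\<And>A B. A \<in> sets borel \<Longrightarrow> B \<in> sets borel \<Longrightarrow>
      emeasure m (A \<inter> f -` B) = (\<integral>\<^sup>+x\<in>B. emeasure (\<kappa> x) A \<partial>distr m borel f)"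
    using \<kappa> by (auto simp: regular_conditional_prob_def)
  have sets_\<kappa>[measurable_cong]: "sets (\<kappa> x) = sets borel" and prob_\<kappa>: "prob_space (\<kappa> x)" for x
    using measurable_space[of \<kappa> borel "prob_algebra borel" x] by (auto simp: space_prob_algebra)
  have space_\<kappa>: "space (\<kappa> x) = UNIV" for x using sets_eq_imp_space_eq[OF sets_\<kappa>[of x]] by simp
  note [measurable] = measurable_prob_algebraD[OF \<kappa>_meas]
  define U where "U w = emeasure (\<kappa> (f w)) {w'. t w' \<le> t w}" for w
  have U[measurable]: "U \<in> borel_measurable borel"
    unfolding U_def
  proof (rule emeasure_measurable_subprob_algebra2)
    have "{z \<in> space (borel \<Otimes>\<^sub>M borel). t (snd z) \<le> t (fst z)} \<in> sets (borel \<Otimes>\<^sub>M borel)"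
      by measurable
    also have "{z \<in> space (borel \<Otimes>\<^sub>M borel). t (snd z) \<le> t (fst z)} = (SIGMA w:space borel. {w'. t w' \<le> t w})"
      by (auto simp: space_pair_measure)
    finally show "(SIGMA w:space borel. {w'. t w' \<le> t w}) \<in> sets (borel \<Otimes>\<^sub>M borel)" .
  qed measurable
  have "emeasure m {w. f w \<in> A \<and> U w < h (f w)} = (\<integral>\<^sup>+x. h x * indicator A x \<partial>distr m borel f)"
    if [measurable]: "A \<in> sets borel" "h \<in> borel_measurable borel" and h: "\<And>x. h x \<le> 1" for A h
  proof -
    define S where "S = {w. U w < h (f w)}"
    have S[measurable]: "S \<in> sets borel"
      using borel_measurable_less[of U borel "\<lambda>w. h (f w)"] by (simp add: S_def)
    have "{w. f w \<in> A \<and> U w < h (f w)} = S \<inter> f -` A" by (auto simp: S_def)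
    then have "emeasure m {w. f w \<in> A \<and> U w < h (f w)} =
        (\<integral>\<^sup>+x\<in>A. emeasure (\<kappa> x) S \<partial>distr m borel f)"
      using cond[OF S] by simp
    also have "\<dots> = (\<integral>\<^sup>+x. h x * indicator A x \<partial>distr m borel f)"
    proof (rule nn_integral_cong_AE)
      show "AE x in distr m borel f. emeasure (\<kappa> x) S * indicator A x = h x * indicator A x"
        using regular_conditional_prob_fibre[OF m f \<kappa>] atomless
      proof eventually_elim
        case (elim x)
        interpret \<kappa>: prob_space "\<kappa> x" by (rule prob_\<kappa>)
        define D where "D = distr (\<kappa> x) borel t"
        interpret D: real_distribution D
          unfolding D_def by (rule \<kappa>.real_distribution_distr) measurable
        obtain a where a: "h x = ennreal a" "0 \<le> a" "a \<le> 1"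
          using h[of x] by (cases "h x") (auto simp: top_unique)
        have cdf: "emeasure (\<kappa> x) {w'. t w' \<le> s} = ennreal (cdf D s)" for s
        proof -
          have "emeasure D {..s} = emeasure (\<kappa> x) {w'. t w' \<le> s}"
            unfolding D_def by (subst emeasure_distr) (auto simp: space_\<kappa> vimage_def)
          then show ?thesis by (simp add: cdf_def D.emeasure_eq_measure)
        qed
        \<comment> \<open>\<open>\<kappa> x\<close> is concentrated on the fibre over
          \<open>x\<close>, so an atom of \<open>D\<close> would be a level set of \<open>t\<close>
          in this fibre with positive mass.\<close>
        have "measure D {s} = 0" for s
        proof -
          have "emeasure D {s} = emeasure (\<kappa> x) {w. t w = s}"
            unfolding D_def by (subst emeasure_distr) (auto simp: space_\<kappa> vimage_def)
          also have "\<dots> = emeasure (\<kappa> x) {w. f w = x \<and> t w = s}"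
          proof (rule emeasure_eq_AE)
            show "AE w in \<kappa> x. (w \<in> {w. t w = s}) = (w \<in> {w. f w = x \<and> t w = s})"
              using elim(1) by eventually_elim auto
            have "{w. t w = s} = t -` {s}" "{w. f w = x \<and> t w = s} = f -` {x} \<inter> t -` {s}" by auto
            then show "{w. t w = s} \<in> sets (\<kappa> x)" "{w. f w = x \<and> t w = s} \<in> sets (\<kappa> x)"
              using measurable_sets[OF t, of "{s}"] measurable_sets[OF f, of "{x}"]
              by (auto simp: sets_\<kappa>)
          qed
          finally show ?thesis using elim(2) by (simp add: measure_def)
        qed
        from D.measure_cdf_less[OF this a(2,3)]
        have "h x = emeasure D {s. cdf D s < a}" by (simp add: a D.emeasure_eq_measure)
        also have "\<dots> = emeasure (\<kappa> x) {w. cdf D (t w) < a}"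
        proof -
          have [measurable]: "cdf D \<in> borel_measurable borel"
            by (intro borel_measurable_mono) (auto simp: mono_def D.cdf_nondecreasing)
          show ?thesis
            unfolding D_def[symmetric]
            by (subst (1) D_def, subst emeasure_distr) (auto simp: space_\<kappa> vimage_def)
        qed
        also have "\<dots> = emeasure (\<kappa> x) S"
        proof (rule emeasure_eq_AE)
          have [measurable]: "cdf D \<in> borel_measurable borel"
            by (intro borel_measurable_mono) (auto simp: mono_def D.cdf_nondecreasing)
          \<comment> \<open>On the fibre \<open>f w = x\<close> the kernel inside \<open>U w\<close>
            is \<open>\<kappa> x\<close> itself, so \<open>U w\<close> equals
            \<open>cdf D (t w)\<close>.\<close>
          show "AE w in \<kappa> x. (w \<in> {w. cdf D (t w) < a}) = (w \<in> S)"
            using elim(1) by eventually_elim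
              (auto simp: S_def U_def cdf a ennreal_less_iff D.cdf_nonneg)
          show "{w. cdf D (t w) < a} \<in> sets (\<kappa> x)"
            using borel_measurable_less[of "\<lambda>w. cdf D (t w)" borel "\<lambda>_. a"] by (simp add: sets_\<kappa>)
        qed (simp add: sets_\<kappa>)
        finally show ?case by simp
      qed
    qed
    finally show ?thesis .
  qed
  moreover have "U \<in> borel_measurable m" using U measurable_cong_sets[OF m refl] by blast
  moreover have "space m = UNIV" using sets_eq_imp_space_eq[OF m] by simp
  ultimately show ?thesis by (intro that[of U]) (simp add: uniform_given_def)
qed

text \<open>The set covers itself with diameter 0, at no cost for every positive exponent. Points
  thus have the critical dimension \<open>n - 1\<close> when \<open>n = 1\<close>, which is how the
  spread condition excludes atoms on lines.\<close>

lemma hausdorff_dim_singleton: "hausdorff_dim {a} = 0"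
proof -
  have "hausdorff_pre s \<delta> {a} = 0" if "0 < s" "0 < \<delta>" for s \<delta>
  proof -
    have "hausdorff_pre s \<delta> {a} \<le> (\<Sum>i. ennreal (diameter {a} powr s))"
      unfolding hausdorff_pre_def using that by (intro INF_lower) auto
    also have "\<dots> = 0" using that by simp
    finally show ?thesis by simp
  qed
  then have "hausdorff_measure s {a} = 0" if "0 < s" for s
    using that by (simp add: hausdorff_measure_def)
  then have le: "hausdorff_dim {a} \<le> ennreal s" if "0 < s" for s
    unfolding hausdorff_dim_def using that by (intro INF_lower) auto
  have "hausdorff_dim {a} \<le> 0 + ennreal e" if "0 < e" for e
    using le[OF that] by simp
  then have "hausdorff_dim {a} \<le> 0" by (rule ennreal_le_epsilon)
  then show ?thesis by simp
qed

text \<open>The rank-one projection splits \<open>W\<close> into parallel lines, the fibres of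
  \<open>f\<close>. The coordinate \<open>t\<close> determines a point of a given line, so absence
  of atoms on almost every line is the hypothesis of \<open>conditional_uniform\<close>.\<close>

lemma spread_measure_uniform:
  fixes j :: "'h::real_inner \<Rightarrow> 'w::{frechet_space, polish_space}"
  assumes j: "linear j" "inj j" "continuous_on UNIV j" "closure (range j) = UNIV"
    and m: "sets m = sets borel" and spread: "spread_measure j m"
  obtains f :: "'w \<Rightarrow> 'w" and U where
    "f \<in> borel_measurable borel" "\<And>w. w - f w \<in> range j" "uniform_given m borel f U"
proof -
  from spread obtain \<pi> :: "nat \<Rightarrow> 'h \<Rightarrow> 'h" and p :: "nat \<Rightarrow> 'w \<Rightarrow> 'h" where
    *: "\<forall>n\<ge>1. regular_projection j (\<pi> n) (p n) \<and> dim (range (\<pi> n)) = n" and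
    **: "\<forall>n\<ge>1. \<exists>\<kappa>. regular_conditional_prob m (\<lambda>w. w - j (p n w)) \<kappa> \<and>
           (AE x in distr m borel (\<lambda>w. w - j (p n w)).
              \<forall>A\<in>sets borel. A \<subseteq> (\<lambda>h. x + j h) ` range (\<pi> n) \<longrightarrow>
                hausdorff_dim {h \<in> range (\<pi> n). x + j h \<in> A} = ennreal (real n - 1) \<longrightarrow>
                emeasure (\<kappa> x) A = 0)"
    unfolding spread_measure_def by blast
  have reg: "regular_projection j (\<pi> 1) (p 1)" and dim: "dim (range (\<pi> 1)) = 1" using * by auto
  define f where "f w = w - j (p 1 w)" for w
  obtain \<kappa> where \<kappa>: "regular_conditional_prob m f \<kappa>" and
    null: "AE x in distr m borel f.
              \<forall>A\<in>sets borel. A \<subseteq> (\<lambda>h. x + j h) ` range (\<pi> 1) \<longrightarrow>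
                hausdorff_dim {h \<in> range (\<pi> 1). x + j h \<in> A} = 0 \<longrightarrow> emeasure (\<kappa> x) A = 0"
    using **[rule_format, of 1] unfolding f_def by auto
  have p: "continuous_on UNIV (p 1)" "\<And>h. p 1 (j h) = \<pi> 1 h"
    using reg by (auto simp: regular_projection_def)
  have sub: "subspace (range (\<pi> 1))"
    using reg by (auto simp: regular_projection_def fin_dim_orthogonal_projection_def)
  obtain b where b: "b \<subseteq> range (\<pi> 1)" "independent b" "range (\<pi> 1) \<subseteq> span b" "card b = 1"
    using basis_exists[of "range (\<pi> 1)"] unfolding dim by blast
  have "range (\<pi> 1) = span b" using span_subspace[OF b(1,3) sub] by simp
  moreover obtain v where "b = {v}" using b(4) by (auto simp: card_1_singleton_iff)
  ultimately have v: "v \<noteq> 0" "range (\<pi> 1) = span {v}"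
    using b(2) dependent_zero[of b] by auto
  \<comment> \<open>On \<open>H\<close> this holds because \<open>p 1\<close> extends
    \<open>\<pi> 1\<close>, whose range is spanned by \<open>v\<close>; both sides are continuous
    and \<open>H\<close> is dense in \<open>W\<close>.\<close>
  have line: "p 1 w = ((p 1 w \<bullet> v) / (v \<bullet> v)) *\<^sub>R v" for w
  proof -
    have "closed {w. p 1 w = ((p 1 w \<bullet> v) / (v \<bullet> v)) *\<^sub>R v}"
      using p(1) v(1) by (intro closed_Collect_eq continuous_intros) auto
    moreover have "range j \<subseteq> {w. p 1 w = ((p 1 w \<bullet> v) / (v \<bullet> v)) *\<^sub>R v}"
    proof safe
      fix h
      have "\<pi> 1 h \<in> span {v}" using v(2) by blast
      then obtain c where "\<pi> 1 h = c *\<^sub>R v" by (auto simp: span_singleton)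
      then show "p 1 (j h) = ((p 1 (j h) \<bullet> v) / (v \<bullet> v)) *\<^sub>R v" using v(1) p(2)[of h] by simp
    qed
    ultimately have "closure (range j) \<subseteq> {w. p 1 w = ((p 1 w \<bullet> v) / (v \<bullet> v)) *\<^sub>R v}"
      by (rule closure_minimal[rotated])
    then show ?thesis using j(4) by auto
  qed
  have "continuous_on UNIV (\<lambda>w. j (p 1 w))"
    using continuous_on_compose2[OF j(3) p(1)] by simp
  then have "continuous_on UNIV f" unfolding f_def by (intro continuous_intros)
  then have f: "f \<in> borel_measurable borel" by (rule borel_measurable_continuous_onI)
  define t where "t w = p 1 w \<bullet> v" for w
  have t: "t \<in> borel_measurable borel"
    unfolding t_def using p(1) by (intro borel_measurable_continuous_onI continuous_intros)
  have "AE x in distr m borel f. \<forall>s. emeasure (\<kappa> x) {w. f w = x \<and> t w = s} = 0"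
    using null
  proof eventually_elim
    case (elim x)
    show ?case
    proof
      fix s
      \<comment> \<open>The point of the line with coordinate \<open>s\<close>: as \<open>v\<close>
        is not normalized, \<open>t w = s\<close> forces \<open>p 1 w = h\<close>, hence
        \<open>w = x + j h\<close> on the fibre over \<open>x\<close>.\<close>
      define h where "h = (s / (v \<bullet> v)) *\<^sub>R v"
      have "h \<in> range (\<pi> 1)" unfolding v(2) h_def by (intro span_scale span_base) simp
      then have "{h' \<in> range (\<pi> 1). x + j h' \<in> {x + j h}} = {h}"
        using j(2) by (auto dest: injD)
      with elim \<open>h \<in> range (\<pi> 1)\<close> have "emeasure (\<kappa> x) {x + j h} = 0"
        by (auto simp: hausdorff_dim_singleton dest: bspec[of _ _ "{x + j h}"])
      moreover have "{w. f w = x \<and> t w = s} \<subseteq> {x + j h}"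
        using line by (auto simp: f_def t_def h_def)
      moreover have "sets (\<kappa> x) = sets borel"
        using \<kappa> measurable_space[of \<kappa> borel "prob_algebra borel" x]
        by (auto simp: space_prob_algebra regular_conditional_prob_def)
      ultimately show "emeasure (\<kappa> x) {w. f w = x \<and> t w = s} = 0"
        using emeasure_mono[of "{w. f w = x \<and> t w = s}" "{x + j h}" "\<kappa> x"] by simp
    qed
  qed
  then obtain U where U: "uniform_given m borel f U"
    by (rule conditional_uniform[OF m f t \<kappa>])
  have "w - f w \<in> range j" for w by (simp add: f_def)
  from that[OF f this U] show ?thesis .
qed

subsection \<open>Couplings along \<open>H\<close>\<close>

lemma measurable_fst_diff_snd[measurable]:
  "(\<lambda>z. fst z - snd z) \<in> borel \<Otimes>\<^sub>M borel \<rightarrow>\<^sub>M (borel :: 'w::{frechet_space, polish_space} measure)"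
proof -
  have "(\<lambda>z::'w \<times> 'w. fst z - snd z) \<in> borel_measurable borel"
    by (intro borel_measurable_continuous_onI continuous_intros)
  then show ?thesis by (simp add: borel_prod)
qed

text \<open>A finite infimum is witnessed by a coupling of finite cost, whose integrand is finite
  almost everywhere; \<open>H_norm\<close> is finite exactly on \<open>H\<close>.\<close>

lemma couplings_finite_cost_AE:
  fixes j :: "'h::{real_inner, complete_space} \<Rightarrow> 'w::{frechet_space, polish_space}"
  assumes j: "linear j" "inj j" "continuous_on UNIV j" and fin: "wasserstein j \<xi> \<eta> < \<top>"
  obtains \<beta> where "\<beta> \<in> couplings \<xi> \<eta>" "AE z in \<beta>. fst z - snd z \<in> range j"
proof -
  have "wasserstein_sq j \<xi> \<eta> < \<top>"
    using fin by (auto simp: wasserstein_def less_top split: if_splits)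
  then obtain \<beta> where \<beta>: "\<beta> \<in> couplings \<xi> \<eta>"
    and int: "(\<integral>\<^sup>+ z. (H_norm j (fst z - snd z))\<^sup>2 \<partial>\<beta>) < \<top>"
    unfolding wasserstein_sq_def INF_less_iff by blast
  have [measurable_cong]: "sets \<beta> = sets (borel \<Otimes>\<^sub>M borel)" using \<beta> by (simp add: couplings_def)
  note [measurable] = borel_measurable_H_norm[OF j]
  have "AE z in \<beta>. (H_norm j (fst z - snd z))\<^sup>2 \<noteq> \<infinity>"
    using int by (intro nn_integral_PInf_AE) auto
  then have "AE z in \<beta>. fst z - snd z \<in> range j"
    by (rule AE_mp) (auto simp flip: H_norm_less_top_iff simp: less_top[symmetric] power_eq_top_ennreal)
  with \<beta> show ?thesis by (rule that)
qed

text \<open>Mix the couplings of \<open>\<rho>\<close> with the normalized pieces of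
  \<open>\<nu>\<close>, weighted by the masses of the cells: every first marginal is
  \<open>\<rho>\<close>, and the second marginals average to \<open>\<nu>\<close>.\<close>

lemma locally_finite_wasserstein_coupling:
  fixes j :: "'h::{real_inner, complete_space} \<Rightarrow> 'w::{frechet_space, polish_space}"
  assumes j: "linear j" "inj j" "continuous_on UNIV j"
    and \<rho>: "prob_space \<rho>" "sets \<rho> = sets borel" and \<nu>: "prob_space \<nu>" "sets \<nu> = sets borel"
    and lfw: "locally_finite_wasserstein j \<rho> \<nu>"
  obtains \<beta> where "\<beta> \<in> couplings \<rho> \<nu>" "AE z in \<beta>. fst z - snd z \<in> range j"
proof -
  interpret \<rho>: prob_space \<rho> by fact
  interpret \<nu>: prob_space \<nu> by fact
  note [measurable_cong] = \<rho>(2) \<nu>(2)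
  have space_\<nu>: "space \<nu> = UNIV" using sets_eq_imp_space_eq[OF \<nu>(2)] by simp
  obtain P where P: "countable P" "partition_on UNIV P" "P \<subseteq> sets borel"
    and pos: "\<And>Z. Z \<in> P \<Longrightarrow> emeasure \<nu> Z > 0"
    and fin: "\<And>Z. Z \<in> P \<Longrightarrow> wasserstein j \<rho> (uniform_measure \<nu> Z) < \<top>"
    using lfw unfolding locally_finite_wasserstein_def by blast
  have P_sets: "Z \<in> sets \<nu>" if "Z \<in> P" for Z using P(3) that \<nu>(2) by auto
  have disj: "disjoint_family_on (\<lambda>Z. Z) P"
    using P(2) by (auto simp: partition_on_def disjoint_family_on_def disjoint_def)
  have Un: "\<Union>P = UNIV" using P(2) by (auto simp: partition_on_def)
  have "\<exists>\<beta>. \<beta> \<in> couplings \<rho> (uniform_measure \<nu> Z) \<and> (AE z in \<beta>. fst z - snd z \<in> range j)" if "Z \<in> P" for Z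
    using couplings_finite_cost_AE[OF j fin[OF that]] by metis
  then obtain b where b: "\<And>Z. Z \<in> P \<Longrightarrow> b Z \<in> couplings \<rho> (uniform_measure \<nu> Z)"
    and b_AE: "\<And>Z. Z \<in> P \<Longrightarrow> AE z in b Z. fst z - snd z \<in> range j"
    by metis
  \<comment> \<open>The law of a random cell; its total mass is 1 because the cells partition
    \<open>W\<close>.\<close>
  define I where "I = density (count_space P) (emeasure \<nu>)"
  have space_I[simp]: "space I = P" by (simp add: I_def)
  have sum: "(\<integral>\<^sup>+Z. emeasure \<nu> (Z \<inter> A) \<partial>count_space P) = emeasure \<nu> A" if "A \<in> sets borel" for A
  proof -
    have "emeasure \<nu> (\<Union>Z\<in>P. Z \<inter> A) = (\<integral>\<^sup>+Z. emeasure \<nu> (Z \<inter> A) \<partial>count_space P)"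
      using P_sets that disj P(1) \<nu>(2)
      by (intro emeasure_UN_countable) (auto simp: disjoint_family_on_def)
    moreover have "(\<Union>Z\<in>P. Z \<inter> A) = A" using Un by auto
    ultimately show ?thesis by simp
  qed
  interpret I: prob_space I
  proof
    have "emeasure I (space I) = (\<integral>\<^sup>+Z. emeasure \<nu> Z \<partial>count_space P)"
      unfolding I_def by (simp add: emeasure_density) (intro nn_integral_cong, simp)
    then show "emeasure I (space I) = 1"
      using sum[of UNIV] \<nu>.emeasure_space_1 by (simp add: space_\<nu>)
  qed
  have ne: "space I \<noteq> {}" using I.not_empty .
  have prob_b: "prob_space (b Z)" and sets_b: "sets (b Z) = sets (borel \<Otimes>\<^sub>M borel)"
    and fst_b: "distr (b Z) borel fst = \<rho>" and snd_b: "distr (b Z) borel snd = uniform_measure \<nu> Z" if "Z \<in> P" for Z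
    using b[OF that] by (auto simp: couplings_def)
  have b_meas: "b \<in> I \<rightarrow>\<^sub>M subprob_algebra (borel \<Otimes>\<^sub>M borel)"
    unfolding I_def using prob_b sets_b
    by (subst measurable_cong_sets[OF sets_density refl])
      (auto simp: space_subprob_algebra prob_space_imp_subprob_space)
  define \<beta> where "\<beta> = I \<bind> b"
  have "prob_space \<beta>"
    unfolding \<beta>_def by (rule I.prob_space_bind[OF _ b_meas]) (auto intro!: AE_I2 prob_b)
  moreover have "sets \<beta> = sets (borel \<Otimes>\<^sub>M borel)"
    unfolding \<beta>_def using sets_b ne by (intro sets_bind) auto
  moreover have "distr \<beta> borel fst = \<rho>"
  proof -
    have "distr \<beta> borel fst = I \<bind> (\<lambda>Z. distr (b Z) borel fst)"
      unfolding \<beta>_def by (rule distr_bind[OF b_meas ne]) measurable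
    also have "\<dots> = I \<bind> (\<lambda>_. \<rho>)" by (rule bind_cong) (auto simp: fst_b)
    also have "\<dots> = \<rho>"
      by (rule bind_const'[OF I.prob_space_axioms]) (rule prob_space_imp_subprob_space[OF \<rho>(1)])
    finally show ?thesis .
  qed
  moreover have "distr \<beta> borel snd = \<nu>"
  proof (rule measure_eqI)
    fix A assume "A \<in> sets (distr \<beta> borel snd)"
    then have A[measurable]: "A \<in> sets borel" by simp
    have "distr \<beta> borel snd = I \<bind> (\<lambda>Z. distr (b Z) borel snd)"
      unfolding \<beta>_def by (rule distr_bind[OF b_meas ne]) measurable
    also have "emeasure \<dots> A = (\<integral>\<^sup>+Z. emeasure (distr (b Z) borel snd) A \<partial>I)"
      by (rule emeasure_bind[OF ne _ A])
        (rule measurable_compose[OF b_meas measurable_distr], measurable)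
    also have "\<dots> = (\<integral>\<^sup>+Z. emeasure \<nu> Z * emeasure (distr (b Z) borel snd) A \<partial>count_space P)"
      unfolding I_def by (rule nn_integral_density) auto
    also have "\<dots> = (\<integral>\<^sup>+Z. emeasure \<nu> (Z \<inter> A) \<partial>count_space P)"
    proof (rule nn_integral_cong)
      fix Z assume "Z \<in> space (count_space P)"
      then have Z: "Z \<in> P" by simp
      have "emeasure (distr (b Z) borel snd) A = emeasure \<nu> (Z \<inter> A) / emeasure \<nu> Z"
        unfolding snd_b[OF Z] using P_sets[OF Z] A \<nu>(2) by (intro emeasure_uniform_measure) auto
      \<comment> \<open>The weight cancels the normalization because the mass of the cell is
        positive and finite.\<close>
      then show "emeasure \<nu> Z * emeasure (distr (b Z) borel snd) A = emeasure \<nu> (Z \<inter> A)"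
        using pos[OF Z] by (metis ennreal_times_divide mult.commute mult_divide_eq_ennreal
            \<nu>.emeasure_finite less_irrefl infinity_ennreal_def)
    qed
    also have "\<dots> = emeasure \<nu> A" by (rule sum) measurable
    finally show "emeasure (distr \<beta> borel snd) A = emeasure \<nu> A" .
  qed (simp add: \<nu>(2))
  moreover have "AE z in \<beta>. fst z - snd z \<in> range j"
    unfolding \<beta>_def
  proof (subst AE_bind[OF b_meas])
    note [measurable] = sets_borel_range[OF j]
    show "Measurable.pred (borel \<Otimes>\<^sub>M borel) (\<lambda>z::'w \<times> 'w. fst z - snd z \<in> range j)" by measurable
    show "AE Z in I. AE z in b Z. fst z - snd z \<in> range j" by (rule AE_I2, rule b_AE) simp
  qed
  ultimately show ?thesis by (intro that[of \<beta>]) (auto simp: couplings_def)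
qed

section \<open>The perturbation of identity carrying \<open>\<rho>\<close> to
  \<open>\<nu>\<close>\<close>

theorem theorem6p11:
  fixes j :: "'h::{real_inner, polish_space} \<Rightarrow> 'w::{frechet_space, polish_space}"
    and \<rho> \<nu> :: "'w measure"
  assumes "linear j" and "inj j" and "continuous_on UNIV j" and "closure (range j) = UNIV"
    and "prob_space \<rho>" and "sets \<rho> = sets borel"
    and "prob_space \<nu>" and "sets \<nu> = sets borel"
    and "locally_finite_wasserstein j \<rho> \<nu>"
    and "spread_measure j \<rho>"
  shows "\<exists>T \<xi> :: 'w \<Rightarrow> 'w.
           T \<in> borel_measurable borel \<and> (\<forall>w. T w = w + \<xi> w) \<and>
           (AE w in \<rho>. \<xi> w \<in> range j) \<and> distr \<rho> borel T = \<nu>"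
proof -
  note j = assms(1-4)
  note [measurable_cong] = assms(6,8)
  have sub: "subspace (range j)" using linear_subspace_image[OF j(1) subspace_UNIV] .
  obtain f :: "'w \<Rightarrow> 'w" and U where f[measurable]: "f \<in> borel_measurable borel"
    and f_range: "\<And>w. w - f w \<in> range j" and unif: "uniform_given \<rho> borel f U"
    by (rule spread_measure_uniform[OF j assms(6,10)]) (rule that)
  obtain \<beta> where \<beta>: "\<beta> \<in> couplings \<rho> \<nu>" and \<beta>_AE: "AE z in \<beta>. fst z - snd z \<in> range j"
    by (rule locally_finite_wasserstein_coupling[OF j(1-3) assms(5-9)]) (rule that)
  have prob_\<beta>: "prob_space \<beta>" and [measurable_cong]: "sets \<beta> = sets (borel \<Otimes>\<^sub>M borel)"
    and fst_\<beta>: "distr \<beta> borel fst = \<rho>" and snd_\<beta>: "distr \<beta> borel snd = \<nu>"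
    using \<beta> by (auto simp: couplings_def)
  have eq: "distr \<rho> borel f = distr \<beta> borel (\<lambda>z. f (fst z))"
    by (subst fst_\<beta>[symmetric], subst distr_distr) (auto simp: comp_def)
  \<comment> \<open>Only \<open>f (fst z)\<close>, not \<open>fst z\<close>, is matched: the
    position of \<open>w\<close> on its line serves as randomness for \<open>T w\<close>, and it
    affects \<open>T w - w\<close> only by an element of \<open>H\<close>.\<close>
  have "\<exists>T\<in>borel_measurable \<rho>. distr \<rho> (borel \<Otimes>\<^sub>M borel) (\<lambda>w. (f w, T w)) =
      distr \<beta> (borel \<Otimes>\<^sub>M borel) (\<lambda>z. (f (fst z), snd z))"
    by (rule realize_coupling[OF assms(5) prob_\<beta> _ _ _ eq unif]) measurable
  then obtain T where T\<rho>: "T \<in> borel_measurable \<rho>"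
    and T: "distr \<rho> (borel \<Otimes>\<^sub>M borel) (\<lambda>w. (f w, T w)) =
      distr \<beta> (borel \<Otimes>\<^sub>M borel) (\<lambda>z. (f (fst z), snd z))"
    by blast
  have T_meas[measurable]: "T \<in> borel_measurable borel"
    using T\<rho> measurable_cong_sets[OF assms(6) refl] by blast
  have "distr \<rho> borel T = distr (distr \<rho> (borel \<Otimes>\<^sub>M borel) (\<lambda>w. (f w, T w))) borel snd"
    by (subst distr_distr) (auto simp: comp_def)
  also have "\<dots> = \<nu>"
    unfolding T by (subst distr_distr) (auto simp: comp_def snd_\<beta>)
  finally have "distr \<rho> borel T = \<nu>" .
  moreover have "AE w in \<rho>. T w - w \<in> range j"
  proof -
    note [measurable] = sets_borel_range[OF j(1-3)]
    \<comment> \<open>Measurability of this event lets the almost-sure statement pass through both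
      image measures, from \<open>\<beta>\<close> to the common joint law and on to
      \<open>\<rho>\<close>.\<close>
    have E: "{z \<in> space (borel \<Otimes>\<^sub>M borel). (fst z :: 'w) - snd z \<in> range j} \<in> sets (borel \<Otimes>\<^sub>M borel)"
      by measurable
    have "AE z in \<beta>. f (fst z) - snd z \<in> range j"
      using \<beta>_AE
    proof eventually_elim
      case (elim z)
      from subspace_diff[OF sub this f_range[of "fst z"]] show ?case by simp
    qed
    then have "AE z in distr \<beta> (borel \<Otimes>\<^sub>M borel) (\<lambda>z. (f (fst z), snd z)). fst z - snd z \<in> range j"
      by (subst AE_distr_iff[OF _ E]) auto
    then have "AE w in \<rho>. f w - T w \<in> range j"
      unfolding T[symmetric] by (subst (asm) AE_distr_iff[OF _ E]) auto
    then show ?thesis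
    proof eventually_elim
      case (elim w)
      \<comment> \<open>\<open>T w - w\<close> is the negative of the sum of
        \<open>f w - T w\<close> and \<open>w - f w\<close>, both in \<open>H\<close>.\<close>
      from subspace_neg[OF sub subspace_add[OF sub this f_range[of w]]] show ?case by simp
    qed
  qed
  ultimately show ?thesis
    using T_meas by (intro exI[of _ T] exI[of _ "\<lambda>w. T w - w"]) auto
qed

end
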